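(* Assume $m\le n$, $R\succeq I$, $Q\succeq I$, $(A_\star,B_\star)$ stabilizable, and $\|A_\star\|,\|B_\star\|,\|P_\star\|\le\Upsilon_\star$ with $\Upsilon_\star\ge\max\{1,\varepsilon_\mathrm{m}\}$. Let $(\hat A,\hat B)$ satisfy $\max\{\|\hat A-A_\star\|,\|\hat B-B_\star\|\}\le\varepsilon_\mathrm{m}$, let $P\in\mathbb{S}^n_+$ with $\|P-P_\star\|\le\varepsilon_\mathrm{p}$ ($\varepsilon_\mathrm{p}\ge0$), and let $i\ge0$ be an integer. If $\varepsilon_\mathrm{m}<1/(8\|P_\star\|^2)$ and $\gamma_1(\varepsilon_\mathrm{m},\varepsilon_\mathrm{p})\gamma_2(\varepsilon_\mathrm{m})<1$, then $$\|\mathcal{R}^{(i)}_{\hat A,\hat B}(P)-P_\star\|\le\widehat E(\varepsilon_\mathrm{m},\varepsilon_\mathrm{p},i):=\sqrt{\alpha_{\varepsilon_\mathrm{m}}}\,\beta_\star\Big\{(\gamma_1\gamma_2)^i\varepsilon_\mathrm{p}+\tilde\psi(\varepsilon_\mathrm{m})\frac{1-(\gamma_1\gamma_2)^i}{1-\gamma_1\gamma_2}\Big\},$$ with $\gamma_1=\gamma_1(\varepsilon_\mathrm{m},\varepsilon_\mathrm{p})$, $\gamma_2=\gamma_2(\varepsilon_\mathrm{m})$.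
   Context: $A_\star,\hat A\in\mathbb{R}^{n\times n}$, $B_\star,\hat B\in\mathbb{R}^{n\times m}$, weights $Q\in\mathbb{S}^n_+$, $R\in\mathbb{S}^m_{++}$; $\|\cdot\|$ spectral norm; $\overline\sigma,\underline\sigma$ largest/smallest singular values. $S_B=BR^{-1}B^\top$; Riccati map $\mathcal{R}_{A,B}(P)=A^\top P(I+S_BP)^{-1}A+Q$, iterates $\mathcal{R}^{(0)}=\mathrm{id}$, $\mathcal{R}^{(i+1)}=\mathcal{R}\circ\mathcal{R}^{(i)}$. $P_\star$ is the unique positive definite solution of $P_\star=\mathcal{R}_{A_\star,B_\star}(P_\star)$; $\beta_\star=\overline{\sigma}(P_\star)/\underline{\sigma}(Q)$. Define $\psi(\varepsilon_\mathrm{m},\varepsilon_\mathrm{p})=\varepsilon_\mathrm{m}[1+(\varepsilon_\mathrm{m}+2\Upsilon_\star)^2(\beta_\star\varepsilon_\mathrm{p}+\Upsilon_\star)]$, $\gamma_1(\varepsilon_\mathrm{m},\varepsilon_\mathrm{p})=\sqrt{\beta_\star}\psi(\varepsilon_\mathrm{m},\varepsilon_\mathrm{p})+\sqrt{1-\beta_\star^{-1}}$, $\alpha_{\varepsilon_\mathrm{m}}=(1-8\|P_\star\|^2\varepsilon_\mathrm{m})^{-1/2}$, $\gamma_2(\varepsilon_\mathrm{m})=\sqrt{1-\alpha_{\varepsilon_\mathrm{m}}^{-1}\beta_\star^{-1}}$, and $\tilde\psi(\varepsilon_\mathrm{m})=(\varepsilon_\mathrm{m}^2+2\Upsilon_\star\varepsilon_\mathrm{m})[\Upsilon_\star+(\varepsilon_\mathrm{m}+\Upsilon_\star)^2\Upsilon_\star^2]$.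 *)

theory Defs
  imports "HOL-Analysis.Analysis"
begin

definition spec_norm :: "real^'c^'r \<Rightarrow> real" where
  "spec_norm A = onorm (\<lambda>x. A *v x)"

definition sigma_min :: "real^'n^'n \<Rightarrow> real" where
  "sigma_min A = Inf {norm (A *v x) | x. norm x = 1}"

definition psd :: "real^'n^'n \<Rightarrow> bool" where
  "psd A \<longleftrightarrow> transpose A = A \<and> (\<forall>x. 0 \<le> x \<bullet> (A *v x))"

definition pd :: "real^'n^'n \<Rightarrow> bool" where
  "pd A \<longleftrightarrow> transpose A = A \<and> (\<forall>x. x \<noteq> 0 \<longrightarrow> 0 < x \<bullet> (A *v x))"

definition cmat :: "real^'c^'r \<Rightarrow> complex^'c^'r" where
  "cmat A = (\<chi> i j. complex_of_real (A $ i $ j))"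

definition schur_stable :: "real^'n^'n \<Rightarrow> bool" where
  "schur_stable A \<longleftrightarrow>
     (\<forall>(c::complex) (v::complex^'n). v \<noteq> 0 \<and> cmat A *v v = c *s v \<longrightarrow> cmod c < 1)"

definition stabilizable :: "real^'n^'n \<Rightarrow> real^'m^'n \<Rightarrow> bool" where
  "stabilizable A B \<longleftrightarrow> (\<exists>K::real^'n^'m. schur_stable (A + B ** K))"

definition S_mat :: "real^'m^'n \<Rightarrow> real^'m^'m \<Rightarrow> real^'n^'n" where
  "S_mat B R = B ** matrix_inv R ** transpose B"

definition riccati :: "real^'n^'n \<Rightarrow> real^'m^'n \<Rightarrow> real^'n^'n \<Rightarrow> real^'m^'m
                       \<Rightarrow> real^'n^'n \<Rightarrow> real^'n^'n" where
  "riccati A B Q R P =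
     transpose A ** P ** matrix_inv (mat 1 + S_mat B R ** P) ** A + Q"

definition psi_fn :: "real \<Rightarrow> real \<Rightarrow> real \<Rightarrow> real \<Rightarrow> real" where
  "psi_fn Ups beta em ep = em * (1 + (em + 2 * Ups)^2 * (beta * ep + Ups))"

definition gamma1 :: "real \<Rightarrow> real \<Rightarrow> real \<Rightarrow> real \<Rightarrow> real" where
  "gamma1 Ups beta em ep = sqrt beta * psi_fn Ups beta em ep + sqrt (1 - 1 / beta)"

definition alpha_fn :: "real \<Rightarrow> real \<Rightarrow> real" where
  "alpha_fn normP em = 1 / sqrt (1 - 8 * normP^2 * em)"

definition gamma2 :: "real \<Rightarrow> real \<Rightarrow> real \<Rightarrow> real" where
  "gamma2 normP beta em = sqrt (1 - 1 / (alpha_fn normP em * beta))"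

definition psi_tilde :: "real \<Rightarrow> real \<Rightarrow> real" where
  "psi_tilde Ups em = (em^2 + 2 * Ups * em) * (Ups + (em + Ups)^2 * Ups^2)"

end

theory Submission
  imports Defs
begin

text \<open>
  The Riccati map is the value of a one-step minimisation,
  \<open>x \<bullet> \<R>(X) x = min\<^sub>u (A x + B u) \<bullet> X (A x + B u) + x \<bullet> Q x + u \<bullet> R u\<close>, so it is monotone and
  concave. The error of the iterates is measured relative to \<open>P\<^sub>\<star>\<close>: if
  \<open>(1 - d) P\<^sub>\<star> \<le> X \<le> (1 + d) P\<^sub>\<star>\<close>, then one step of the perturbed map gives the same bounds with
  \<open>d\<close> replaced by \<open>\<gamma>\<^sub>1 \<gamma>\<^sub>2 d + \<psi>' / \<sigma>\<close>, where \<open>\<psi>'\<close> is \<open>psi_tilde\<close> and \<open>\<sigma>\<close> is \<open>sigma_min Q\<close>. For the upper bound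
  the input optimal for the nominal system is used in the perturbed one; the resulting closed loop
  contracts the squared \<open>P\<^sub>\<star>\<close>-norm both by \<open>\<gamma>\<^sub>1\<^sup>2\<close> and by \<open>\<gamma>\<^sub>2\<^sup>2\<close>, hence by \<open>\<gamma>\<^sub>1 \<gamma>\<^sub>2\<close>. For the lower
  bound concavity gives the factor \<open>1 - 1 / \<beta>\<^sub>\<star> \<le> \<gamma>\<^sub>1 \<gamma>\<^sub>2\<close>.
\<close>

section \<open>Positive semidefinite quadratic forms and the spectral norm\<close>

lemma transpose_add: "transpose (A + B) = transpose A + transpose (B :: real^'n^'m)"
  by (simp add: transpose_def vec_eq_iff)

lemma matrix_add_mult: "(A + B) ** C = A ** C + B ** (C :: real^'n^'m)"
  by (simp add: matrix_eq matrix_vector_mult_add_rdistrib flip: matrix_vector_mul_assoc)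

lemma inner_transpose_mult:
  fixes A :: "real^'n^'m"
  shows "x \<bullet> (transpose A *v y) = (A *v x) \<bullet> y"
  by (metis dot_lmul_matrix inner_commute transpose_matrix_vector)

lemma inner_symmetric_mult:
  fixes A :: "real^'n^'n"
  assumes "transpose A = A"
  shows "x \<bullet> (A *v y) = y \<bullet> (A *v x)"
  by (metis assms inner_commute inner_transpose_mult)

lemma quadratic_form_add:
  fixes A :: "real^'n^'n"
  assumes "transpose A = A"
  shows "(x + y) \<bullet> (A *v (x + y)) = x \<bullet> (A *v x) + 2 * (x \<bullet> (A *v y)) + y \<bullet> (A *v y)"
  using inner_symmetric_mult[OF assms, of x y]
  by (simp add: matrix_vector_right_distrib inner_add_left inner_add_right)

lemma quadratic_form_scaleR:
  fixes A :: "real^'n^'n"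
  shows "(c *\<^sub>R x) \<bullet> (A *v (c *\<^sub>R x)) = c\<^sup>2 * (x \<bullet> (A *v x))"
  by (simp add: matrix_vector_mult_scaleR power2_eq_square)

lemma pd_imp_psd: "pd A \<Longrightarrow> psd A"
  unfolding pd_def psd_def by (metis inner_zero_left less_eq_real_def)

text \<open>The form at \<open>x + t *\<^sub>R y\<close> is a nonnegative quadratic in
  \<open>t\<close>, so its discriminant is not positive. The form may be degenerate, hence the
  separate case \<open>c = 0\<close>.\<close>

lemma psd_Cauchy_Schwarz:
  fixes A :: "real^'n^'n"
  assumes "psd A"
  shows "(x \<bullet> (A *v y))\<^sup>2 \<le> (x \<bullet> (A *v x)) * (y \<bullet> (A *v y))"
proof -
  define a b c where "a = x \<bullet> (A *v x)" and "b = x \<bullet> (A *v y)" and "c = y \<bullet> (A *v y)"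
  have sym: "transpose A = A" and nn: "0 \<le> z \<bullet> (A *v z)" for z
    using assms unfolding psd_def by auto
  have q: "0 \<le> a + 2 * t * b + t\<^sup>2 * c" for t
    using nn[of "x + t *\<^sub>R y"]
    by (simp only: quadratic_form_add[OF sym] quadratic_form_scaleR)
       (simp add: a_def b_def c_def matrix_vector_mult_scaleR)
  have c0: "0 \<le> c" using nn by (simp add: c_def)
  have "b\<^sup>2 \<le> a * c"
  proof (cases "c = 0")
    case True
    have "b = 0"
    proof (rule ccontr)
      assume b: "b \<noteq> 0"
      \<comment> \<open>For \<open>c = 0\<close> this \<open>t\<close> gives the quadratic the value
        -1.\<close>
      then show False using q[of "- (a + 1) / (2 * b)"] True by (simp add: field_simps)
    qed
    then show ?thesis using True by simp
  next
    case False
    then have c: "c > 0" using c0 by simp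
    \<comment> \<open>\<open>- b / c\<close> is the minimiser of the quadratic.\<close>
    have "0 \<le> (a + 2 * (- b / c) * b + (- b / c)\<^sup>2 * c) * c"
      using q[of "- b / c"] c by (intro mult_nonneg_nonneg) simp_all
    also have "\<dots> = a * c - b\<^sup>2" using c by (simp add: field_simps power2_eq_square)
    finally show ?thesis by simp
  qed
  then show ?thesis unfolding a_def b_def c_def .
qed

text \<open>Cauchy-Schwarz for the pair \<open>A *v x\<close>, \<open>x\<close> bounds the fourth
  power of \<open>norm (A *v x)\<close> by 0.\<close>

lemma psd_mult_eq_0:
  fixes A :: "real^'n^'n"
  assumes "psd A" "x \<bullet> (A *v x) = 0"
  shows "A *v x = 0"
proof -
  have "((A *v x) \<bullet> (A *v x))\<^sup>2 \<le> 0"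
    using psd_Cauchy_Schwarz[OF assms(1), of "A *v x" x] assms(2) by simp
  then show ?thesis by simp
qed

lemma psd_diff_mat_1:
  fixes A :: "real^'n^'n"
  assumes "psd (A - mat 1)"
  shows "(norm x)\<^sup>2 \<le> x \<bullet> (A *v x)"
proof -
  have "0 \<le> x \<bullet> ((A - mat 1) *v x)" using assms by (simp add: psd_def)
  then show ?thesis
    by (simp add: matrix_vector_mult_diff_rdistrib inner_diff_right power2_norm_eq_inner)
qed

section \<open>Spectral norm and smallest singular value\<close>

lemma norm_mult_le_spec_norm: "norm (A *v x) \<le> spec_norm A * norm x"
  unfolding spec_norm_def by (rule onorm) simp

lemma spec_norm_nonneg: "0 \<le> spec_norm A"
  unfolding spec_norm_def by (rule onorm_pos_le) simp

lemma norm_mult_le: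
  assumes "spec_norm A \<le> c"
  shows "norm (A *v x) \<le> c * norm x"
  using norm_mult_le_spec_norm[of A x] mult_right_mono[OF assms, of "norm x"] by simp

lemma inner_mult_le:
  assumes "spec_norm A \<le> c"
  shows "x \<bullet> (A *v y) \<le> c * (norm x * norm y)"
proof -
  have "x \<bullet> (A *v y) \<le> norm x * norm (A *v y)" by (rule norm_cauchy_schwarz)
  also have "\<dots> \<le> norm x * (c * norm y)"
    by (intro mult_left_mono norm_mult_le assms) simp
  finally show ?thesis by (simp add: algebra_simps)
qed

text \<open>Polarisation: the form at \<open>z + y\<close> and \<open>z - y\<close>, combined by the
  parallelogram law, controls \<open>z \<bullet> (A *v y)\<close>, and a suitable \<open>z\<close>
  turns this into \<open>norm (A *v x)\<close>.\<close>

lemma spec_norm_le_symmetric: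
  fixes A :: "real^'n^'n"
  assumes sym: "transpose A = A" and bd: "\<And>x. \<bar>x \<bullet> (A *v x)\<bar> \<le> c * (norm x)\<^sup>2"
  shows "spec_norm A \<le> c"
  unfolding spec_norm_def
proof (rule onorm_le)
  fix x :: "real^'n"
  show "norm (A *v x) \<le> c * norm x"
  proof (cases "x = 0 \<or> A *v x = 0")
    case True
    have "0 \<le> c * (norm x)\<^sup>2" using bd[of x] by linarith
    then have "0 \<le> c * norm x"
      by (cases "x = 0") (auto simp: zero_le_mult_iff)
    then show ?thesis using True by auto
  next
    case False
    \<comment> \<open>Rescaling \<open>x\<close> to the length of \<open>y\<close> makes the
      parallelogram sum \<open>4 * (norm y)\<^sup>2\<close>, while
      \<open>z \<bullet> (A *v y)\<close> becomes \<open>r * (norm y)\<^sup>2\<close>.\<close>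
    define r where "r = norm (A *v x) / norm x"
    define z where "z = r *\<^sub>R x"
    define y where "y = A *v x"
    have r: "r > 0" using False by (simp add: r_def)
    have nz: "norm z = norm y" using False by (simp add: z_def y_def r_def)
    have "4 * (z \<bullet> (A *v y)) = (z + y) \<bullet> (A *v (z + y)) - (z - y) \<bullet> (A *v (z - y))"
      using inner_symmetric_mult[OF sym, of z y]
      by (simp add: matrix_vector_right_distrib matrix_vector_mult_diff_distrib
          inner_add_left inner_add_right inner_diff_left inner_diff_right)
    also have "\<dots> \<le> c * (norm (z + y))\<^sup>2 + c * (norm (z - y))\<^sup>2"
      using bd[of "z + y"] bd[of "z - y"] by linarith
    also have "\<dots> = c * (4 * (norm y)\<^sup>2)"
    proof -
      have "(norm (z + y))\<^sup>2 + (norm (z - y))\<^sup>2 = 2 * (norm z)\<^sup>2 + 2 * (norm y)\<^sup>2"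
        by (simp add: power2_norm_eq_inner inner_add_left inner_add_right inner_diff_left
            inner_diff_right inner_commute)
      then show ?thesis using nz by (simp flip: distrib_left)
    qed
    finally have "z \<bullet> (A *v y) \<le> c * (norm y)\<^sup>2" by simp
    moreover have "z \<bullet> (A *v y) = r * (norm y)\<^sup>2"
      using inner_symmetric_mult[OF sym, of z y]
      by (simp add: z_def y_def matrix_vector_mult_scaleR power2_norm_eq_inner)
    ultimately have "r * (norm y)\<^sup>2 \<le> c * (norm y)\<^sup>2" by simp
    then have "r \<le> c" using False by (simp add: y_def)
    then show ?thesis using False by (simp add: r_def field_simps)
  qed
qed

lemma sigma_min_le:
  assumes "norm x = 1"
  shows "sigma_min A \<le> norm (A *v x)"
  unfolding sigma_min_def
  by (rule cInf_lower) (use assms in \<open>auto intro: bdd_belowI[of _ 0]\<close>)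

text \<open>\<open>sigma_min\<close> is an infimum of norms, not of form values. The two meet at a
  minimiser of the form on the unit sphere, where the norm equals the form value.\<close>

lemma sigma_min_psd:
  fixes A :: "real^'n^'n"
  assumes "psd A"
  shows "sigma_min A * (norm x)\<^sup>2 \<le> x \<bullet> (A *v x)"
proof -
  let ?S = "sphere (0 :: real^'n) 1"
  have "continuous_on ?S (\<lambda>x. x \<bullet> (A *v x))"
    by (intro continuous_intros linear_continuous_on) simp
  moreover have "?S \<noteq> {}" by simp
  ultimately obtain u where u: "norm u = 1" and
    umin: "\<And>x. norm x = 1 \<Longrightarrow> u \<bullet> (A *v u) \<le> x \<bullet> (A *v x)"
    using continuous_attains_inf[OF compact_sphere, of 0 1 "\<lambda>x::real^'n. x \<bullet> (A *v x)"]
    by (auto simp: dist_norm)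
  define l where "l = u \<bullet> (A *v u)"
  have l: "l * (norm x)\<^sup>2 \<le> x \<bullet> (A *v x)" for x
  proof (cases "x = 0")
    case False
    define z where "z = (1 / norm x) *\<^sub>R x"
    have "norm z = 1" and x: "x = norm x *\<^sub>R z" using False by (simp_all add: z_def)
    then have "l \<le> z \<bullet> (A *v z)" using umin l_def by simp
    moreover have "x \<bullet> (A *v x) = (norm x)\<^sup>2 * (z \<bullet> (A *v z))"
      by (subst (1 2) x) (rule quadratic_form_scaleR)
    ultimately show ?thesis using mult_right_mono[of l _ "(norm x)\<^sup>2"] by (simp add: mult.commute)
  qed simp
  \<comment> \<open>The minimiser \<open>u\<close> is an eigenvector: \<open>u\<close> annihilates the positive semidefinite form \<open>A - l I\<close>.\<close>
  have "transpose (A - l *\<^sub>R mat 1) = A - l *\<^sub>R mat 1"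
    using assms by (auto simp: psd_def transpose_def vec_eq_iff mat_def)
  moreover have "0 \<le> x \<bullet> ((A - l *\<^sub>R mat 1) *v x)" for x
    using l[of x] by (simp add: matrix_vector_mult_diff_rdistrib inner_diff_right
        scaleR_matrix_vector_assoc[symmetric] power2_norm_eq_inner)
  ultimately have "psd (A - l *\<^sub>R mat 1)" by (simp add: psd_def)
  moreover have "u \<bullet> ((A - l *\<^sub>R mat 1) *v u) = 0"
    using u by (simp add: matrix_vector_mult_diff_rdistrib inner_diff_right
        scaleR_matrix_vector_assoc[symmetric] l_def norm_eq_1)
  ultimately have "(A - l *\<^sub>R mat 1) *v u = 0" by (rule psd_mult_eq_0)
  then have "A *v u = l *\<^sub>R u"
    by (simp add: matrix_vector_mult_diff_rdistrib scaleR_matrix_vector_assoc[symmetric])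
  moreover have "0 \<le> l" using assms by (simp add: l_def psd_def)
  ultimately have "sigma_min A \<le> l" using sigma_min_le[OF u, of A] u by simp
  then show ?thesis using l[of x] mult_right_mono[of "sigma_min A" l "(norm x)\<^sup>2"] by simp
qed

section \<open>The Riccati map as a minimal cost\<close>

definition lqr_cost :: "real^'n^'n \<Rightarrow> real^'m^'n \<Rightarrow> real^'n^'n \<Rightarrow> real^'m^'m
                        \<Rightarrow> real^'n^'n \<Rightarrow> real^'n \<Rightarrow> real^'m \<Rightarrow> real" where
  "lqr_cost A B Q R X x u =
     (A *v x + B *v u) \<bullet> (X *v (A *v x + B *v u)) + x \<bullet> (Q *v x) + u \<bullet> (R *v u)"

lemma matrix_inv_of_trivial_kernel:
  fixes A :: "real^'n^'n"
  assumes "\<And>x. A *v x = 0 \<Longrightarrow> x = 0"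
  shows "A ** matrix_inv A = mat 1" "matrix_inv A ** A = mat 1"
proof -
  have "invertible A"
    using assms by (auto simp: invertible_left_inverse matrix_left_invertible_ker)
  then have "A ** matrix_inv A = mat 1 \<and> matrix_inv A ** A = mat 1"
    unfolding matrix_inv_def invertible_def by (rule someI_ex)
  then show "A ** matrix_inv A = mat 1" "matrix_inv A ** A = mat 1" by auto
qed

locale lqr_weights =
  fixes Q :: "real^'n^'n" and R :: "real^'m^'m"
  assumes psd_Q: "psd Q" and Q_ge_1: "psd (Q - mat 1)"
    and psd_R: "psd R" and R_ge_1: "psd (R - mat 1)"
begin

lemma R_inv: "R ** matrix_inv R = mat 1" "matrix_inv R ** R = mat 1"
proof -
  have "x = 0" if "R *v x = 0" for x
    using psd_diff_mat_1[OF R_ge_1, of x] that by simp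
  then show "R ** matrix_inv R = mat 1" "matrix_inv R ** R = mat 1"
    by (rule matrix_inv_of_trivial_kernel, blast)+
qed

lemma R_inv_mult: "R *v (matrix_inv R *v x) = x"
  by (simp add: matrix_vector_mul_assoc R_inv)

lemma transpose_R_inv: "transpose (matrix_inv R) = matrix_inv R"
proof -
  have "transpose (R ** matrix_inv R) = mat 1" by (simp add: R_inv)
  then have "transpose (matrix_inv R) ** R = mat 1"
    using psd_R by (simp add: matrix_transpose_mul psd_def)
  then show ?thesis
    by (metis R_inv(1) matrix_mul_assoc matrix_mul_lid matrix_mul_rid)
qed

text \<open>Exhibits \<open>S_mat B R\<close> as \<open>R\<close> pulled back along
  \<open>matrix_inv R ** transpose B\<close>: nonnegativity is inherited from \<open>R\<close>, and
  at \<open>X *v y\<close> the form is the input cost of the optimal feedback.\<close>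

lemma S_mat_form:
  "x \<bullet> (S_mat B R *v y) = (matrix_inv R *v (transpose B *v x)) \<bullet> (R *v (matrix_inv R *v (transpose B *v y)))"
  unfolding R_inv_mult S_mat_def
  by (metis inner_commute inner_transpose_mult matrix_vector_mul_assoc transpose_R_inv transpose_transpose)

lemma transpose_S_mat: "transpose (S_mat B R) = S_mat B R"
  by (simp add: S_mat_def matrix_transpose_mul transpose_R_inv matrix_mul_assoc)

text \<open>On the kernel of \<open>mat 1 + S_mat B R ** X\<close> the form of \<open>X\<close> at
  \<open>y\<close> is minus that of \<open>S_mat B R\<close> at \<open>X *v y\<close>; both are
  nonnegative, so \<open>X *v y = 0\<close> and then \<open>y = 0\<close>. The second part follows
  from symmetry of \<open>X\<close> and \<open>S_mat B R\<close> and makes the Riccati map preserve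
  symmetry.\<close>

lemma riccati_factor:
  assumes X: "psd X"
  shows "(mat 1 + S_mat B R ** X) ** matrix_inv (mat 1 + S_mat B R ** X) = mat 1"
    and "X ** matrix_inv (mat 1 + S_mat B R ** X) = transpose (matrix_inv (mat 1 + S_mat B R ** X)) ** X"
proof -
  define G where "G = mat 1 + S_mat B R ** X"
  have "y = 0" if "G *v y = 0" for y
  proof -
    have y: "y = - (S_mat B R *v (X *v y))"
      using that by (simp add: G_def matrix_vector_mult_add_rdistrib matrix_vector_mul_assoc
          eq_neg_iff_add_eq_0)
    have "0 \<le> (X *v y) \<bullet> (S_mat B R *v (X *v y))"
      using psd_R unfolding S_mat_form by (simp add: psd_def)
    moreover have "y \<bullet> (X *v y) = - ((X *v y) \<bullet> (S_mat B R *v (X *v y)))"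
      by (metis y inner_commute inner_minus_right)
    moreover have "0 \<le> y \<bullet> (X *v y)" using X by (simp add: psd_def)
    ultimately have "X *v y = 0" by (intro psd_mult_eq_0[OF X]) linarith
    then show ?thesis using y by simp
  qed
  note GF = matrix_inv_of_trivial_kernel[of G, OF this]
  show "(mat 1 + S_mat B R ** X) ** matrix_inv (mat 1 + S_mat B R ** X) = mat 1"
    using GF(1) by (simp add: G_def)
  have "transpose X = X" using X by (simp add: psd_def)
  then have XG: "X ** G = transpose G ** X"
    by (simp add: G_def matrix_add_ldistrib matrix_transpose_mul transpose_S_mat
        transpose_add matrix_add_mult matrix_mul_assoc)
  have "transpose (G ** matrix_inv G) = mat 1" by (simp add: GF)
  then have "X ** matrix_inv G = transpose (matrix_inv G) ** (transpose G ** X) ** matrix_inv G"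
    by (simp add: matrix_transpose_mul matrix_mul_assoc)
  also have "\<dots> = transpose (matrix_inv G) ** X ** (G ** matrix_inv G)"
    by (simp only: XG[symmetric] matrix_mul_assoc)
  finally show "X ** matrix_inv (mat 1 + S_mat B R ** X) = transpose (matrix_inv (mat 1 + S_mat B R ** X)) ** X"
    by (simp only: GF(1) matrix_mul_rid G_def[symmetric])
qed

text \<open>Completing the square around the stationary input.\<close>

lemma riccati_optimal_input:
  assumes X: "psd X"
  obtains u where "lqr_cost A B Q R X x u = x \<bullet> (riccati A B Q R X *v x)"
    and "\<And>v. lqr_cost A B Q R X x u \<le> lqr_cost A B Q R X x v"
proof -
  define F where "F = matrix_inv (mat 1 + S_mat B R ** X)"
  \<comment> \<open>\<open>y\<close> turns out to be the optimal next state (\<open>yu\<close>), and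
    \<open>u\<close> is its feedback.\<close>
  define y where "y = F *v (A *v x)"
  define u where "u = - (matrix_inv R *v (transpose B *v (X *v y)))"
  have symX: "transpose X = X" using X by (simp add: psd_def)
  have symR: "transpose R = R" using psd_R by (simp add: psd_def)
  have "(mat 1 + S_mat B R ** X) *v y = A *v x"
    unfolding y_def F_def by (simp add: matrix_vector_mul_assoc matrix_mul_assoc riccati_factor[OF X])
  then have Ax: "A *v x = y + S_mat B R *v (X *v y)"
    by (simp add: matrix_vector_mult_add_rdistrib matrix_vector_mul_assoc)
  have Bu: "B *v u = - (S_mat B R *v (X *v y))"
    unfolding u_def S_mat_def
    by (simp add: matrix_vector_mul_assoc matrix_mul_assoc vec.neg del: transpose_matrix_vector)
  have yu: "A *v x + B *v u = y" by (simp add: Ax Bu)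
  have Ru: "R *v u = - (transpose B *v (X *v y))"
    by (simp add: u_def vec.neg R_inv_mult del: transpose_matrix_vector)
  have uRu: "u \<bullet> (R *v u) = (X *v y) \<bullet> (S_mat B R *v (X *v y))"
    by (simp add: S_mat_form u_def vec.neg del: transpose_matrix_vector)
  have "x \<bullet> (riccati A B Q R X *v x) = (A *v x) \<bullet> (X *v y) + x \<bullet> (Q *v x)"
    by (simp add: riccati_def matrix_vector_mult_add_rdistrib inner_add_right y_def F_def
        matrix_vector_mul_assoc[symmetric] inner_transpose_mult del: transpose_matrix_vector)
  also have "(A *v x) \<bullet> (X *v y) = y \<bullet> (X *v y) + u \<bullet> (R *v u)"
    unfolding Ax uRu by (simp add: inner_add_right inner_commute[of _ "X *v y"])
  also have "\<dots> + x \<bullet> (Q *v x) = lqr_cost A B Q R X x u"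
    unfolding lqr_cost_def yu by simp
  finally have "lqr_cost A B Q R X x u = x \<bullet> (riccati A B Q R X *v x)" by simp
  moreover have "lqr_cost A B Q R X x u \<le> lqr_cost A B Q R X x v" for v
  proof -
    define w where "w = v - u"
    have v: "v = u + w" and yv: "A *v x + B *v v = y + B *v w"
      using yu by (simp_all add: w_def matrix_vector_mult_diff_distrib algebra_simps)
    have "lqr_cost A B Q R X x v - lqr_cost A B Q R X x u =
      2 * (y \<bullet> (X *v (B *v w)) + u \<bullet> (R *v w)) + (B *v w) \<bullet> (X *v (B *v w)) + w \<bullet> (R *v w)"
      unfolding lqr_cost_def yv yu unfolding v
      by (simp only: quadratic_form_add[OF symX] quadratic_form_add[OF symR]) simp
    \<comment> \<open>By stationarity (\<open>Ru\<close>) the terms linear in \<open>w\<close>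
      cancel, leaving two nonnegative squares.\<close>
    moreover have "u \<bullet> (R *v w) = - (y \<bullet> (X *v (B *v w)))"
      using inner_symmetric_mult[OF symR, of u w] inner_symmetric_mult[OF symX, of y "B *v w"]
      by (simp add: Ru inner_transpose_mult del: transpose_matrix_vector)
    moreover have "0 \<le> (B *v w) \<bullet> (X *v (B *v w))" "0 \<le> w \<bullet> (R *v w)"
      using X psd_R by (simp_all add: psd_def)
    ultimately show ?thesis by simp
  qed
  ultimately show thesis by (rule that)
qed

lemma riccati_le_cost:
  assumes "psd X"
  shows "x \<bullet> (riccati A B Q R X *v x) \<le> lqr_cost A B Q R X x v"
  using riccati_optimal_input[OF assms] by metis

lemma psd_riccati:
  assumes X: "psd X"
  shows "psd (riccati A B Q R X)"
  unfolding psd_def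
proof (intro conjI allI)
  have "transpose X = X" "transpose Q = Q" using X psd_Q by (simp_all add: psd_def)
  then show "transpose (riccati A B Q R X) = riccati A B Q R X"
    using riccati_factor(2)[OF X, of B]
    by (simp add: riccati_def transpose_add matrix_transpose_mul matrix_mul_assoc[symmetric])
next
  fix x
  obtain u where "lqr_cost A B Q R X x u = x \<bullet> (riccati A B Q R X *v x)"
    using riccati_optimal_input[OF X] by metis
  moreover have "0 \<le> lqr_cost A B Q R X x u"
    using X psd_Q psd_R by (simp add: lqr_cost_def psd_def)
  ultimately show "0 \<le> x \<bullet> (riccati A B Q R X *v x)" by simp
qed

end


section \<open>Perturbation of the optimal closed loop\<close>

text \<open>Primes mark the perturbed system; \<open>U\<close> is the norm bound \<Upsilon> and
  \<open>e\<close> the model error.\<close>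

locale lqr_perturbation = lqr_weights Q R
  for Q :: "real^'n^'n" and R :: "real^'m^'m" +
  fixes A A' :: "real^'n^'n" and B B' :: "real^'m^'n" and P :: "real^'n^'n" and U e :: real
  assumes pd_P: "pd P" and P_fixed: "P = riccati A B Q R P"
    and A_le: "spec_norm A \<le> U" and P_le: "spec_norm P \<le> U"
    and U_ge: "1 \<le> U"
    and A_diff: "spec_norm (A' - A) \<le> e" and B_diff: "spec_norm (B' - B) \<le> e"
    and e_less: "e < 1 / (8 * (spec_norm P)\<^sup>2)"
begin

abbreviation "p \<equiv> spec_norm P"
abbreviation "s \<equiv> sigma_min Q"
abbreviation "b \<equiv> p / s"
abbreviation "a \<equiv> alpha_fn p e"

section \<open>Size relations among \<open>P\<close>, \<open>Q\<close> and the constants\<close>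

lemma psd_P: "psd P"
  using pd_P by (rule pd_imp_psd)

lemma sym_P: "transpose P = P"
  using psd_P by (simp add: psd_def)

lemma P_nonneg: "0 \<le> x \<bullet> (P *v x)"
  using psd_P by (simp add: psd_def)

lemma R_ge: "(norm u)\<^sup>2 \<le> u \<bullet> (R *v u)"
  using R_ge_1 by (rule psd_diff_mat_1)

lemma Q_ge: "(norm x)\<^sup>2 \<le> x \<bullet> (Q *v x)"
  using Q_ge_1 by (rule psd_diff_mat_1)

lemma Q_ge_s: "s * (norm x)\<^sup>2 \<le> x \<bullet> (Q *v x)"
  using psd_Q by (rule sigma_min_psd)

text \<open>The form of \<open>P\<close> is an optimal cost, whose remaining terms are
  nonnegative.\<close>

lemma P_ge_Q: "x \<bullet> (Q *v x) \<le> x \<bullet> (P *v x)"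
proof -
  obtain u where "lqr_cost A B Q R P x u = x \<bullet> (P *v x)"
    using riccati_optimal_input[OF psd_P] P_fixed by metis
  moreover have "0 \<le> u \<bullet> (R *v u)" using psd_R by (simp add: psd_def)
  ultimately show ?thesis
    using P_nonneg[of "A *v x + B *v u"] by (simp add: lqr_cost_def)
qed

lemma P_upper: "x \<bullet> (P *v x) \<le> p * (norm x)\<^sup>2"
  using inner_mult_le[of P p x x] by (simp add: power2_eq_square)

lemma s_ge_1: "1 \<le> s"
  unfolding sigma_min_def
proof (rule cInf_greatest)
  show "{norm (Q *v x) |x. norm x = 1} \<noteq> {}"
    using vector_choose_size[of 1] by auto
next
  fix t assume "t \<in> {norm (Q *v x) |x. norm x = 1}"
  then obtain x where x: "norm x = 1" "t = norm (Q *v x)" by auto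
  have "1 \<le> x \<bullet> (Q *v x)" using Q_ge[of x] x by simp
  also have "\<dots> \<le> norm x * norm (Q *v x)" by (rule norm_cauchy_schwarz)
  finally show "1 \<le> t" using x by simp
qed

lemma s_le_p: "s \<le> p"
proof -
  obtain x :: "real^'n" where "norm x = 1" using vector_choose_size[of 1] by auto
  then show ?thesis using Q_ge_s[of x] P_ge_Q[of x] P_upper[of x] by simp
qed

lemma p_ge_1: "1 \<le> p"
  using s_ge_1 s_le_p by simp

lemma b_ge_1: "1 \<le> b"
  using s_ge_1 s_le_p by simp

lemma contraction_nonneg: "0 \<le> 1 - 1 / b"
  using s_le_p p_ge_1 by simp

lemma e_nonneg: "0 \<le> e"
  using spec_norm_nonneg A_diff by (rule order_trans)

lemma e_p_less: "8 * p\<^sup>2 * e < 1"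
  using e_less p_ge_1 by (simp add: field_simps)

lemma e_le: "e \<le> 1 / 8"
proof -
  have "1 * e \<le> p\<^sup>2 * e"
    using p_ge_1 e_nonneg by (intro mult_right_mono) auto
  then show ?thesis using e_p_less by simp
qed

lemma a_ge_1: "1 \<le> a"
  using e_p_less e_nonneg by (simp add: alpha_fn_def divide_simps)

text \<open>This is \<open>sqrt (1 - 2 * t) \<le> 1 - t\<close> at
  \<open>t = 4 * p\<^sup>2 * e\<close>, the shape in which \<alpha> enters the estimate of the
  closed loop.\<close>

lemma inverse_a_le: "1 / a \<le> 1 - 4 * p\<^sup>2 * e"
proof -
  have "1 / a = sqrt (1 - 8 * p\<^sup>2 * e)" by (simp add: alpha_fn_def)
  also have "\<dots> \<le> sqrt ((1 - 4 * p\<^sup>2 * e)\<^sup>2)"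
  proof (rule real_sqrt_le_mono)
    have "0 \<le> (4 * p\<^sup>2 * e)\<^sup>2" by simp
    then show "1 - 8 * p\<^sup>2 * e \<le> (1 - 4 * p\<^sup>2 * e)\<^sup>2"
      unfolding power2_diff by simp
  qed
  also have "\<dots> = 1 - 4 * p\<^sup>2 * e" using e_p_less by simp
  finally show ?thesis .
qed

text \<open>Chains P \<le> p I = b s I \<le> b Q. Hence the stage cost is at least a fraction
  \<open>1 / b\<close> of the value, which is the source of contraction.\<close>

lemma P_le_Q: "x \<bullet> (P *v x) / b \<le> x \<bullet> (Q *v x)"
proof -
  have "x \<bullet> (P *v x) / b \<le> p * (norm x)\<^sup>2 / b"
    using P_upper b_ge_1 by (intro divide_right_mono) auto
  also have "\<dots> = s * (norm x)\<^sup>2" using p_ge_1 by simp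
  also note Q_ge_s
  finally show ?thesis .
qed

lemma norm_le_P: "(norm x)\<^sup>2 \<le> x \<bullet> (P *v x)" "s * (norm x)\<^sup>2 \<le> x \<bullet> (P *v x)"
  using P_ge_Q[of x] Q_ge[of x] Q_ge_s[of x] by simp_all

section \<open>Effect of the model error on one step\<close>

lemma input_error:
  fixes F F' :: "real^'n^'n" and G G' :: "real^'m^'n"
  assumes "spec_norm (F' - F) \<le> e" "spec_norm (G' - G) \<le> e"
  shows "norm ((F' - F) *v x + (G' - G) *v u) \<le> e * (norm x + norm u)"
  using norm_triangle_ineq[of "(F' - F) *v x" "(G' - G) *v u"]
    norm_mult_le[OF assms(1), of x] norm_mult_le[OF assms(2), of u]
  by (simp add: algebra_simps)

lemma psi_tilde_nonneg: "0 \<le> psi_tilde U e"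
  using e_nonneg U_ge by (simp add: psi_tilde_def)

text \<open>
  Comparison with the zero input bounds \<open>(norm y)\<^sup>2 + (norm u)\<^sup>2\<close> jointly by \<open>U (U + e)\<^sup>2 (norm x)\<^sup>2\<close>
  for the next state \<open>y\<close>; bounding the two summands separately would be too weak for \<open>psi_tilde\<close>.
\<close>

lemma model_mismatch:
  fixes F F' :: "real^'n^'n" and G G' :: "real^'m^'n"
  assumes F: "spec_norm F \<le> U + e"
    and d: "spec_norm (F' - F) \<le> e" "spec_norm (G' - G) \<le> e"
    and u: "lqr_cost F G Q R P x u \<le> lqr_cost F G Q R P x 0"
  shows "lqr_cost F' G' Q R P x u \<le> lqr_cost F G Q R P x u + psi_tilde U e * (norm x)\<^sup>2"
proof -
  define y where "y = F *v x + G *v u"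
  define D where "D = (F' - F) *v x + (G' - G) *v u"
  define c where "c = sqrt U * (U + e)"
  have yD: "F' *v x + G' *v u = y + D"
    by (simp add: y_def D_def matrix_vector_mult_diff_rdistrib)
  have c2: "c\<^sup>2 = U * (U + e)\<^sup>2" using U_ge by (simp add: c_def power_mult_distrib)
  have c0: "0 \<le> c" using U_ge e_nonneg by (simp add: c_def)
  have "y \<bullet> (P *v y) + u \<bullet> (R *v u) \<le> (F *v x) \<bullet> (P *v (F *v x))"
    using u by (simp add: lqr_cost_def y_def)
  also have "\<dots> \<le> U * (norm (F *v x))\<^sup>2"
    using P_upper[of "F *v x"] mult_right_mono[OF P_le, of "(norm (F *v x))\<^sup>2"] by simp
  also have "\<dots> \<le> U * ((U + e) * norm x)\<^sup>2"
    using U_ge by (intro mult_left_mono power_mono norm_mult_le F) auto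
  finally have yu: "(norm y)\<^sup>2 + (norm u)\<^sup>2 \<le> c\<^sup>2 * (norm x)\<^sup>2"
    using norm_le_P(1)[of y] R_ge[of u] by (simp add: c2 power_mult_distrib)
  have "(norm u)\<^sup>2 \<le> (c * norm x)\<^sup>2" "(norm y)\<^sup>2 \<le> (c * norm x)\<^sup>2"
    using yu zero_le_power2[of "norm u"] zero_le_power2[of "norm y"]
    unfolding power_mult_distrib by linarith+
  then have nu: "norm u \<le> c * norm x" and ny: "norm y \<le> c * norm x"
    using c0 by (blast intro: power2_le_imp_le mult_nonneg_nonneg norm_ge_zero)+
  have D: "norm D \<le> e * (norm x + norm u)"
    unfolding D_def by (rule input_error[OF d])
  have "lqr_cost F' G' Q R P x u - lqr_cost F G Q R P x u = 2 * (y \<bullet> (P *v D)) + D \<bullet> (P *v D)"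
    using quadratic_form_add[OF sym_P, of y D] by (simp add: lqr_cost_def yD flip: y_def)
  also have "\<dots> \<le> 2 * (U * (norm y * norm D)) + U * (norm D * norm D)"
    by (intro add_mono mult_left_mono inner_mult_le P_le) simp
  also have "\<dots> \<le> 2 * (U * (norm y * (e * (norm x + norm u))))
      + U * ((e * (norm x + norm u)) * (e * (norm x + norm u)))"
    using D U_ge e_nonneg by (intro add_mono mult_left_mono mult_mono) auto
  also have "\<dots> = U * e * (2 * norm y * norm x + 2 * norm y * norm u + e * (norm x + norm u)\<^sup>2)"
    by (simp add: algebra_simps power2_eq_square)
  also have "\<dots> \<le> U * e * ((2 * c + c\<^sup>2 + e * (1 + c)\<^sup>2) * (norm x)\<^sup>2)"
  proof (intro mult_left_mono)
    have "2 * norm y * norm x \<le> 2 * c * (norm x)\<^sup>2"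
      using mult_right_mono[OF ny, of "norm x"] by (simp add: power2_eq_square algebra_simps)
    \<comment> \<open>The joint bound \<open>yu\<close> saves a factor 2 over multiplying
      \<open>ny\<close> and \<open>nu\<close>.\<close>
    moreover have "2 * norm y * norm u \<le> c\<^sup>2 * (norm x)\<^sup>2"
      using yu sum_squares_bound[of "norm y" "norm u"] by simp
    moreover have "e * (norm x + norm u)\<^sup>2 \<le> e * ((1 + c) * norm x)\<^sup>2"
      using nu e_nonneg by (intro mult_left_mono power_mono) (auto simp: algebra_simps)
    ultimately show "2 * norm y * norm x + 2 * norm y * norm u + e * (norm x + norm u)\<^sup>2
        \<le> (2 * c + c\<^sup>2 + e * (1 + c)\<^sup>2) * (norm x)\<^sup>2"
      unfolding power_mult_distrib by (simp add: algebra_simps)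
  qed (use U_ge e_nonneg in auto)
  also have "\<dots> \<le> U * e * (((e + 2 * U) * (1 + c\<^sup>2)) * (norm x)\<^sup>2)"
  proof (intro mult_left_mono mult_right_mono)
    have "2 * c \<le> 1 + c\<^sup>2" using sum_squares_bound[of 1 c] by (simp add: power2_eq_square)
    then have "2 * c * e \<le> (1 + c\<^sup>2) * (1 / 8)"
      using e_le e_nonneg c0 by (intro mult_mono) auto
    moreover have "2 * (1 + c\<^sup>2) \<le> 2 * U * (1 + c\<^sup>2)"
      using U_ge by (intro mult_right_mono) auto
    \<comment> \<open>By U \<ge> 1 and the bound on \<open>2 * c * e\<close>, eight times the gap is
      at least \<open>7 * c\<^sup>2 - 16 * c + 15\<close>, and seven times that is
      \<open>(7 * c - 8)\<^sup>2 + 41\<close>.\<close>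
    moreover have "0 \<le> (7 * c - 8)\<^sup>2" by simp
    ultimately show "2 * c + c\<^sup>2 + e * (1 + c)\<^sup>2 \<le> (e + 2 * U) * (1 + c\<^sup>2)"
      by (simp add: power2_eq_square algebra_simps)
  qed (use U_ge e_nonneg in auto)
  also have "\<dots> = psi_tilde U e * (norm x)\<^sup>2"
    unfolding psi_tilde_def c2 by (simp add: power2_eq_square algebra_simps)
  finally show ?thesis by simp
qed

text \<open>\<open>model_mismatch\<close> with the roles exchanged: the input optimal for the
  perturbed system is tried in the nominal one. The base matrix is then \<open>A'\<close>, whose
  norm is at most \<open>U + e\<close>.\<close>

lemma P_le_perturbed_riccati:
  "x \<bullet> (P *v x) - psi_tilde U e * (norm x)\<^sup>2 \<le> x \<bullet> (riccati A' B' Q R P *v x)"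
proof -
  obtain u where u: "lqr_cost A' B' Q R P x u = x \<bullet> (riccati A' B' Q R P *v x)"
      "\<And>v. lqr_cost A' B' Q R P x u \<le> lqr_cost A' B' Q R P x v"
    using riccati_optimal_input[OF psd_P] by metis
  have neg: "spec_norm (C - D) = spec_norm (D - C)" for C D :: "real^'k^'l"
    unfolding spec_norm_def
    by (metis (no_types, lifting) matrix_vector_mult_diff_rdistrib minus_diff_eq onorm_neg ext)
  have "norm (A' *v x) \<le> (U + e) * norm x" for x
    using norm_triangle_ineq[of "A *v x" "(A' - A) *v x"] norm_mult_le[OF A_le, of x]
      norm_mult_le[OF A_diff, of x]
    by (simp add: matrix_vector_mult_diff_rdistrib algebra_simps)
  then have "spec_norm A' \<le> U + e" unfolding spec_norm_def by (rule onorm_le)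
  then have "lqr_cost A B Q R P x u \<le> lqr_cost A' B' Q R P x u + psi_tilde U e * (norm x)\<^sup>2"
    using A_diff B_diff u(2) by (intro model_mismatch) (simp_all add: neg[of A] neg[of B])
  moreover have "x \<bullet> (P *v x) \<le> lqr_cost A B Q R P x u"
    using riccati_le_cost[OF psd_P] P_fixed by metis
  ultimately show ?thesis using u(1) by simp
qed

text \<open>The perturbed next state is \<open>y + D\<close>, with \<open>y\<close> the nominal one.
  For \<open>gamma2\<close> the effect of \<open>D\<close> is charged to the stage cost; for
  \<open>gamma1\<close> the triangle inequality is used in the \<open>P\<close>-norm.\<close>

lemma perturbed_input:
  obtains u where "lqr_cost A B Q R P x u = x \<bullet> (P *v x)"
    and "lqr_cost A' B' Q R P x u \<le> x \<bullet> (P *v x) + psi_tilde U e * (norm x)\<^sup>2"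
    and "(A' *v x + B' *v u) \<bullet> (P *v (A' *v x + B' *v u)) \<le> (gamma2 p b e)\<^sup>2 * (x \<bullet> (P *v x))"
    and "0 \<le> ep \<Longrightarrow>
      (A' *v x + B' *v u) \<bullet> (P *v (A' *v x + B' *v u)) \<le> (gamma1 U b e ep)\<^sup>2 * (x \<bullet> (P *v x))"
proof -
  define N where "N = x \<bullet> (P *v x)"
  obtain u where u: "lqr_cost A B Q R P x u = N"
      "\<And>v. lqr_cost A B Q R P x u \<le> lqr_cost A B Q R P x v"
    using riccati_optimal_input[OF psd_P] P_fixed unfolding N_def by metis
  define y where "y = A *v x + B *v u"
  define D where "D = (A' - A) *v x + (B' - B) *v u"
  define z where "z = A' *v x + B' *v u"
  have zD: "z = y + D"
    by (simp add: y_def D_def z_def matrix_vector_mult_diff_rdistrib)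
  have N0: "0 \<le> N" by (simp add: N_def P_nonneg)
  have split: "N = y \<bullet> (P *v y) + x \<bullet> (Q *v x) + u \<bullet> (R *v u)"
    using u(1) by (simp add: lqr_cost_def y_def)
  have D: "norm D \<le> e * (norm x + norm u)"
    unfolding D_def by (rule input_error[OF A_diff B_diff])
  have z: "z \<bullet> (P *v z) = y \<bullet> (P *v y) + 2 * (y \<bullet> (P *v D)) + D \<bullet> (P *v D)"
    unfolding zD by (rule quadratic_form_add[OF sym_P])
  have sqrt_p: "sqrt p \<le> p"
    using p_ge_1 by (intro real_le_lsqrt) (simp_all add: power2_eq_square)
  \<comment> \<open>The value splits into next-state cost and stage cost and is at most
    \<open>p * (norm x)\<^sup>2\<close>, which bounds \<open>y\<close> and \<open>u\<close>
    together.\<close>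
  have ny: "norm y \<le> p * norm x" and nu: "norm u \<le> p * norm x"
  proof -
    have "(norm y)\<^sup>2 + (norm u)\<^sup>2 \<le> (sqrt p * norm x)\<^sup>2"
      using split norm_le_P(1)[of y] R_ge[of u] Q_ge[of x] P_upper[of x] zero_le_power2[of "norm x"]
      unfolding N_def power_mult_distrib real_sqrt_pow2[OF spec_norm_nonneg] by linarith
    then have "(norm y)\<^sup>2 \<le> (sqrt p * norm x)\<^sup>2" "(norm u)\<^sup>2 \<le> (sqrt p * norm x)\<^sup>2"
      using zero_le_power2[of "norm u"] zero_le_power2[of "norm y"] by linarith+
    moreover have "0 \<le> sqrt p * norm x" using p_ge_1 by simp
    ultimately have "norm y \<le> sqrt p * norm x" "norm u \<le> sqrt p * norm x"
      by (blast intro: power2_le_imp_le)+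
    then show "norm y \<le> p * norm x" "norm u \<le> p * norm x"
      using mult_right_mono[OF sqrt_p, of "norm x"] by simp_all
  qed
  define st where "st = x \<bullet> (Q *v x) + u \<bullet> (R *v u)"
  have st_b: "N / b \<le> st"
    using P_le_Q[of x] R_ge[of u] zero_le_power2[of "norm u"] unfolding st_def N_def by linarith
  have st_split: "y \<bullet> (P *v y) = N - st" using split by (simp add: st_def)
  show thesis
  proof (rule that[of u])
    show "lqr_cost A B Q R P x u = x \<bullet> (P *v x)" using u(1) by (simp add: N_def)
    show "lqr_cost A' B' Q R P x u \<le> x \<bullet> (P *v x) + psi_tilde U e * (norm x)\<^sup>2"
      using model_mismatch[of A A' B' B x u] A_le e_nonneg A_diff B_diff u
      by (simp add: N_def)
  next
    define w where "w = (norm x)\<^sup>2 + (norm u)\<^sup>2"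
    have w: "w \<le> st" using Q_ge[of x] R_ge[of u] by (simp add: w_def st_def)
    have xu: "2 * (norm x * norm u) \<le> w"
      using sum_squares_bound[of "norm x" "norm u"] by (simp add: w_def)
    have w0: "0 \<le> w" by (simp add: w_def)
    have "y \<bullet> (P *v D) \<le> p * (norm y * norm D)" by (rule inner_mult_le) simp
    also have "\<dots> \<le> p * ((p * norm x) * (e * (norm x + norm u)))"
      using ny D p_ge_1 by (intro mult_left_mono mult_mono) auto
    also have "\<dots> = p\<^sup>2 * e * ((norm x)\<^sup>2 + norm x * norm u)"
      by (simp add: power2_eq_square algebra_simps)
    also have "\<dots> \<le> p\<^sup>2 * e * (3 / 2 * w)"
    proof (intro mult_left_mono)
      show "(norm x)\<^sup>2 + norm x * norm u \<le> 3 / 2 * w"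
      proof -
        have "(norm x)\<^sup>2 \<le> w" by (simp add: w_def)
        then show ?thesis using xu by linarith
      qed
    qed (use e_nonneg in simp)
    finally have yD: "y \<bullet> (P *v D) \<le> p\<^sup>2 * e * w * (3 / 2)" by simp
    have "D \<bullet> (P *v D) \<le> p * (norm D)\<^sup>2" by (rule P_upper)
    also have "\<dots> \<le> p * (e * (norm x + norm u))\<^sup>2"
      using D p_ge_1 by (intro mult_left_mono power_mono) auto
    also have "\<dots> = p * (e * (e * (norm x + norm u)\<^sup>2))"
      by (simp add: power2_eq_square)
    also have "\<dots> \<le> p\<^sup>2 * (e * (1 / 8 * (2 * w)))"
    proof (intro mult_mono)
      show "p \<le> p\<^sup>2" using p_ge_1 by (simp add: power2_eq_square)
      show "(norm x + norm u)\<^sup>2 \<le> 2 * w"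
        using xu by (simp add: w_def power2_sum)
    qed (use e_le e_nonneg w0 in auto)
    finally have DD: "D \<bullet> (P *v D) \<le> p\<^sup>2 * e * w * (1 / 4)" by simp
    have "0 \<le> p\<^sup>2 * e * w" using e_nonneg w0 by simp
    \<comment> \<open>The factors add up to 2 * 3/2 + 1/4 \<le> 4, the coefficient in
      \<open>inverse_a_le\<close>. The perturbation thus consumes at most the fraction
      \<open>1 - 1 / a\<close> of the decrease \<open>st\<close>.\<close>
    then have "2 * (y \<bullet> (P *v D)) + D \<bullet> (P *v D) \<le> (4 * p\<^sup>2 * e) * w"
      using yD DD by linarith
    also have "\<dots> \<le> (1 - 1 / a) * st"
      using inverse_a_le w w0 a_ge_1 by (intro mult_mono) auto
    finally have "z \<bullet> (P *v z) \<le> N - st / a"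
      unfolding z st_split by (simp add: algebra_simps)
    also have "\<dots> \<le> N - (N / b) / a"
      using st_b a_ge_1 by (intro diff_left_mono divide_right_mono) auto
    also have "\<dots> = (1 - 1 / (a * b)) * N"
      by (simp add: algebra_simps)
    also have "1 - 1 / (a * b) = (gamma2 p b e)\<^sup>2"
    proof -
      have "1 * 1 \<le> a * b" using a_ge_1 b_ge_1 by (intro mult_mono) auto
      moreover have "0 \<le> 1 - 1 / t" if "1 * 1 \<le> t" for t :: real using that by simp
      ultimately have "0 \<le> 1 - 1 / (a * b)" by blast
      then show ?thesis unfolding gamma2_def by (rule real_sqrt_pow2[symmetric])
    qed
    finally show "(A' *v x + B' *v u) \<bullet> (P *v (A' *v x + B' *v u)) \<le> (gamma2 p b e)\<^sup>2 * (x \<bullet> (P *v x))"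
      by (simp add: z_def N_def)
  next
    assume ep: "0 \<le> ep"
    define h where "h = psi_fn U b e ep"
    have "0 \<le> b * ep" by (rule mult_nonneg_nonneg[OF _ ep]) (use b_ge_1 in linarith)
    \<comment> \<open>The bracket in \<open>psi_fn\<close> is at least 1 + U \<ge> 1 + p, which
      covers the growth of the input error.\<close>
    then have "1 * U \<le> (e + 2 * U)\<^sup>2 * (b * ep + U)"
      using U_ge e_nonneg by (intro mult_mono) (auto intro: one_le_power)
    then have eh: "e * (1 + p) \<le> h"
      using e_nonneg P_le unfolding h_def psi_fn_def by (intro mult_left_mono) auto
    have h0: "0 \<le> h"
      using e_nonneg p_ge_1 by (intro order_trans[OF _ eh] mult_nonneg_nonneg) auto
    \<comment> \<open>\<open>P\<close>-norm factors relative to \<open>x\<close>: \<open>c1\<close>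
      for the nominal next state, \<open>c2\<close> for \<open>D\<close>. The root of
      \<open>b\<close> in \<open>c2\<close> arises from \<open>p = b * s\<close>, since
      \<open>D\<close> is measured by \<open>p\<close> and \<open>x\<close> by
      \<open>s\<close>.\<close>
    define c1 c2 where "c1 = sqrt (1 - 1 / b)" and "c2 = sqrt b * h"
    have c0: "0 \<le> c1" "0 \<le> c2" using s_ge_1 s_le_p h0 by (simp_all add: c1_def c2_def)
    have c1: "c1\<^sup>2 = 1 - 1 / b" and c2: "c2\<^sup>2 = b * h\<^sup>2"
      using s_ge_1 s_le_p by (simp_all add: c1_def c2_def power_mult_distrib)
    have yy: "y \<bullet> (P *v y) \<le> c1\<^sup>2 * N"
      using st_b unfolding st_split c1 by (simp add: algebra_simps)
    have "e * (norm x + norm u) \<le> e * (norm x + p * norm x)"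
      using nu e_nonneg by (intro mult_left_mono) auto
    also have "\<dots> \<le> h * norm x"
      using mult_right_mono[OF eh, of "norm x"] by (simp add: algebra_simps)
    finally have "norm D \<le> h * norm x" using D by simp
    then have "(norm D)\<^sup>2 \<le> (h * norm x)\<^sup>2" by (intro power_mono) auto
    then have "p * (norm D)\<^sup>2 \<le> p * (h * norm x)\<^sup>2"
      using p_ge_1 by (intro mult_left_mono) auto
    also have "\<dots> = c2\<^sup>2 * (s * (norm x)\<^sup>2)"
      using s_ge_1 by (simp add: c2 power_mult_distrib)
    also have "\<dots> \<le> c2\<^sup>2 * N"
      using norm_le_P(2)[of x] by (intro mult_left_mono) (simp_all add: N_def)
    finally have DD: "D \<bullet> (P *v D) \<le> c2\<^sup>2 * N" using P_upper[of D] by simp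
    have "(y \<bullet> (P *v D))\<^sup>2 \<le> (y \<bullet> (P *v y)) * (D \<bullet> (P *v D))"
      by (rule psd_Cauchy_Schwarz[OF psd_P])
    also have "\<dots> \<le> (c1\<^sup>2 * N) * (c2\<^sup>2 * N)"
      using yy DD P_nonneg N0 by (intro mult_mono) auto
    also have "\<dots> = (c1 * c2 * N)\<^sup>2" by (simp add: power2_eq_square)
    finally have "y \<bullet> (P *v D) \<le> c1 * c2 * N"
      using c0 N0 by (auto dest: power2_le_imp_le)
    then have "z \<bullet> (P *v z) \<le> (c2 + c1)\<^sup>2 * N"
      using yy DD unfolding z by (simp add: power2_sum algebra_simps)
    also have "c2 + c1 = gamma1 U b e ep"
      by (simp add: gamma1_def c1_def c2_def h_def)
    finally show "(A' *v x + B' *v u) \<bullet> (P *v (A' *v x + B' *v u)) \<le> (gamma1 U b e ep)\<^sup>2 * (x \<bullet> (P *v x))"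
      by (simp add: z_def N_def)
  qed
qed

section \<open>Propagation of relative error bounds\<close>

context
  fixes ep g :: real
  assumes ep: "0 \<le> ep" and g_def: "g = gamma1 U b e ep * gamma2 p b e"
begin

text \<open>\<open>sqrt (1 - 1 / b)\<close> is the value of both factors at zero model error; psi
  \<ge> 0 and a \<ge> 1 can only raise it.\<close>

lemma gammas_ge: "sqrt (1 - 1 / b) \<le> gamma1 U b e ep" "sqrt (1 - 1 / b) \<le> gamma2 p b e"
proof -
  have "0 \<le> psi_fn U b e ep"
    using U_ge e_nonneg ep b_ge_1 unfolding psi_fn_def
    by (intro mult_nonneg_nonneg add_nonneg_nonneg) auto
  then show "sqrt (1 - 1 / b) \<le> gamma1 U b e ep"
    using b_ge_1 by (simp add: gamma1_def)
  have "b \<le> a * b"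
    using a_ge_1 b_ge_1 mult_right_mono[of 1 a b] by simp
  moreover have "0 < a" "0 < b" using a_ge_1 b_ge_1 by linarith+
  ultimately have "1 / (a * b) \<le> 1 / b"
    by (intro divide_left_mono mult_pos_pos zero_le_one)
  then show "sqrt (1 - 1 / b) \<le> gamma2 p b e"
    unfolding gamma2_def by (intro real_sqrt_le_mono) linarith
qed

lemma gammas_nonneg: "0 \<le> gamma1 U b e ep" "0 \<le> gamma2 p b e"
  using gammas_ge real_sqrt_ge_zero[OF contraction_nonneg] by (blast intro: order_trans)+

lemma g_ge: "1 - 1 / b \<le> g"
proof -
  have "1 - 1 / b = sqrt (1 - 1 / b) * sqrt (1 - 1 / b)"
    by (simp only: real_sqrt_pow2[OF contraction_nonneg] flip: power2_eq_square)
  also have "\<dots> \<le> g"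
    unfolding g_def
    by (intro mult_mono gammas_ge gammas_nonneg real_sqrt_ge_zero contraction_nonneg)
  finally show ?thesis .
qed

lemma g_nonneg: "0 \<le> g"
  using gammas_nonneg by (simp add: g_def)

text \<open>Turns the additive mismatch into an error relative to \<open>P\<close>.\<close>

lemma psi_tilde_norm_le:
  "psi_tilde U e * (norm x)\<^sup>2 \<le> psi_tilde U e / s * (x \<bullet> (P *v x))"
proof -
  have "psi_tilde U e / s * (s * (norm x)\<^sup>2) \<le> psi_tilde U e / s * (x \<bullet> (P *v x))"
    using norm_le_P(2)[of x] psi_tilde_nonneg s_ge_1 by (intro mult_left_mono) auto
  then show ?thesis using s_ge_1 by simp
qed

text \<open>The nominal optimal input is a competitor in the perturbed problem. Replacing
  \<open>P\<close> by \<open>X\<close> in its cost adds at most \<open>d\<close> times the form of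
  \<open>P\<close> at the next state \<open>z\<close>.\<close>

lemma riccati_step_upper:
  assumes X: "psd X" and d: "0 \<le> d" and le: "\<And>x. x \<bullet> (X *v x) \<le> (1 + d) * (x \<bullet> (P *v x))"
  shows "x \<bullet> (riccati A' B' Q R X *v x) \<le> (1 + (g * d + psi_tilde U e / s)) * (x \<bullet> (P *v x))"
proof -
  define N where "N = x \<bullet> (P *v x)"
  obtain u where u: "lqr_cost A' B' Q R P x u \<le> N + psi_tilde U e * (norm x)\<^sup>2"
    and z2: "(A' *v x + B' *v u) \<bullet> (P *v (A' *v x + B' *v u)) \<le> (gamma2 p b e)\<^sup>2 * N"
    and z1: "(A' *v x + B' *v u) \<bullet> (P *v (A' *v x + B' *v u)) \<le> (gamma1 U b e ep)\<^sup>2 * N"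
    using perturbed_input[of x] ep unfolding N_def by metis
  define z where "z = A' *v x + B' *v u"
  have "z \<bullet> (P *v z) \<le> g * N"
  \<comment> \<open>The smaller of the two squared factors is at most their product.\<close>
  proof (cases "gamma1 U b e ep \<le> gamma2 p b e")
    case True
    then have "(gamma1 U b e ep)\<^sup>2 * N \<le> g * N"
      unfolding g_def power2_eq_square N_def
      using gammas_nonneg P_nonneg by (intro mult_right_mono mult_left_mono) auto
    then show ?thesis using z1 by (simp add: z_def)
  next
    case False
    then have "(gamma2 p b e)\<^sup>2 * N \<le> g * N"
      unfolding g_def power2_eq_square N_def
      using gammas_nonneg P_nonneg by (intro mult_right_mono) auto
    then show ?thesis using z2 by (simp add: z_def)
  qed
  then have "d * (z \<bullet> (P *v z)) \<le> d * (g * N)" using d by (rule mult_left_mono)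
  moreover have "x \<bullet> (riccati A' B' Q R X *v x) \<le> lqr_cost A' B' Q R X x u"
    using X by (rule riccati_le_cost)
  moreover have "\<dots> \<le> lqr_cost A' B' Q R P x u + d * (z \<bullet> (P *v z))"
    unfolding lqr_cost_def z_def[symmetric] using le[of z] by (simp add: distrib_right)
  moreover note psi_tilde_norm_le[of x]
  ultimately show ?thesis using u by (simp add: N_def[symmetric] algebra_simps)
qed

text \<open>
  The lower bound needs no closed loop: the Riccati map is concave and equals \<open>Q \<ge> P / b\<close> at \<open>0\<close>, so
  moving from \<open>P\<close> towards \<open>0\<close> by a fraction \<open>d\<close> lowers its value by at most a fraction \<open>d (1 - 1 / b)\<close>.
\<close>

lemma riccati_step_lower:
  assumes X: "psd X" and d: "0 \<le> d" and ge: "\<And>x. (1 - d) * (x \<bullet> (P *v x)) \<le> x \<bullet> (X *v x)"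
  shows "(1 - (g * d + psi_tilde U e / s)) * (x \<bullet> (P *v x)) \<le> x \<bullet> (riccati A' B' Q R X *v x)"
proof -
  define N where "N = x \<bullet> (P *v x)"
  define t where "t = psi_tilde U e / s"
  have N0: "0 \<le> N" by (simp add: N_def P_nonneg)
  have t0: "0 \<le> t" using psi_tilde_nonneg s_ge_1 by (simp add: t_def)
  obtain u where u: "lqr_cost A' B' Q R X x u = x \<bullet> (riccati A' B' Q R X *v x)"
    using riccati_optimal_input[OF X] by metis
  define z where "z = A' *v x + B' *v u"
  define st where "st = x \<bullet> (Q *v x) + u \<bullet> (R *v u)"
  have st: "N / b \<le> st"
    using P_le_Q[of x] R_ge[of u] zero_le_power2[of "norm u"] unfolding st_def N_def by linarith
  have cost: "x \<bullet> (riccati A' B' Q R X *v x) = z \<bullet> (X *v z) + st"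
    using u by (simp add: lqr_cost_def z_def st_def)
  have gd: "d * (1 - 1 / b) * N \<le> g * d * N"
    using mult_right_mono[OF g_ge, of "d * N"] d N0 by (simp add: algebra_simps)
  show ?thesis
  proof (cases "d \<le> 1")
    case True
    have "N - t * N \<le> x \<bullet> (riccati A' B' Q R P *v x)"
      using P_le_perturbed_riccati[of x] psi_tilde_norm_le[of x] by (simp add: N_def t_def)
    also have "\<dots> \<le> z \<bullet> (P *v z) + st"
      using riccati_le_cost[OF psd_P, of x A' B' u] by (simp add: lqr_cost_def z_def st_def)
    \<comment> \<open>Concavity for the fixed input \<open>u\<close>: the cost with \<open>X\<close>
      is at least \<open>1 - d\<close> times the cost with \<open>P\<close> plus \<open>d\<close>
      times the cost \<open>st\<close> with terminal weight 0.\<close>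
    finally have "(1 - d) * (N - t * N) \<le> (1 - d) * (z \<bullet> (P *v z) + st)"
      using True by (intro mult_left_mono) auto
    moreover have "d * (N / b) \<le> d * st" using st d by (rule mult_left_mono)
    moreover have "0 \<le> d * (t * N)" using d t0 N0 by simp
    ultimately show ?thesis
      unfolding cost using ge[of z] gd by (simp add: N_def[symmetric] t_def[symmetric] algebra_simps)
  next
    case False
    \<comment> \<open>Here \<open>1 - d\<close> is negative. X \<ge> 0 leaves the stage cost, at
      least \<open>N / b\<close>, which is \<open>N\<close> minus \<open>(1 - 1 / b) * N\<close> and
      so exceeds the bound with factor \<open>d > 1\<close>.\<close>
    have "(1 - d) * (1 - 1 / b) * N \<le> 0"
      using False by (intro mult_nonpos_nonneg contraction_nonneg N0) simp
    then have "(1 - 1 / b) * N \<le> d * (1 - 1 / b) * N"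
      by (simp only: left_diff_distrib mult_1 mult.assoc)
    moreover have "(1 - 1 / b) * N = N - N / b" by (simp add: left_diff_distrib)
    moreover have "0 \<le> t * N" using t0 N0 by simp
    moreover have "0 \<le> z \<bullet> (X *v z)" using X by (simp add: psd_def)
    ultimately show ?thesis
      unfolding cost N_def[symmetric] t_def[symmetric] using gd st
      by (simp only: left_diff_distrib distrib_right mult_1)
  qed
qed

text \<open>\<open>d\<close> is the closed form of the recursion in the step lemmas, a geometric sum
  started at \<open>d 0 = ep / s\<close>; dividing by \<open>s\<close> makes the initial absolute
  error relative to \<open>P\<close>.\<close>

lemma riccati_iterate_bounds:
  fixes X :: "real^'n^'n"
  assumes X: "psd X" and X_diff: "spec_norm (X - P) \<le> ep" and g: "g < 1"
  defines "d i \<equiv> (g ^ i * ep + psi_tilde U e * (1 - g ^ i) / (1 - g)) / s"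
  shows "psd ((riccati A' B' Q R ^^ i) X)"
    and "\<bar>x \<bullet> (((riccati A' B' Q R ^^ i) X - P) *v x)\<bar> \<le> d i * (x \<bullet> (P *v x))"
proof -
  have d0: "0 \<le> d i" for i
    using ep g g_nonneg psi_tilde_nonneg s_ge_1 power_le_one[of g i] unfolding d_def
    by (intro divide_nonneg_nonneg add_nonneg_nonneg mult_nonneg_nonneg) auto
  have dS: "d (Suc i) = g * d i + psi_tilde U e / s" for i
    using g s_ge_1 by (simp add: d_def field_simps)
  have "psd ((riccati A' B' Q R ^^ i) X) \<and>
     (\<forall>x. x \<bullet> ((riccati A' B' Q R ^^ i) X *v x) \<le> (1 + d i) * (x \<bullet> (P *v x))) \<and>
     (\<forall>x. (1 - d i) * (x \<bullet> (P *v x)) \<le> x \<bullet> ((riccati A' B' Q R ^^ i) X *v x))"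
  proof (induction i)
    case 0
    have upper: "x \<bullet> ((X - P) *v x) \<le> d 0 * (x \<bullet> (P *v x))"
      and lower: "- (x \<bullet> ((X - P) *v x)) \<le> d 0 * (x \<bullet> (P *v x))" for x
    proof -
      have "ep / s * (s * (norm x)\<^sup>2) \<le> ep / s * (x \<bullet> (P *v x))"
        using norm_le_P(2)[of x] ep s_ge_1 by (intro mult_left_mono) auto
      then have *: "ep * (norm x)\<^sup>2 \<le> d 0 * (x \<bullet> (P *v x))"
        using s_ge_1 by (simp add: d_def)
      show "x \<bullet> ((X - P) *v x) \<le> d 0 * (x \<bullet> (P *v x))"
        using inner_mult_le[OF X_diff, of x x] * by (simp add: power2_eq_square)
      show "- (x \<bullet> ((X - P) *v x)) \<le> d 0 * (x \<bullet> (P *v x))"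
        using inner_mult_le[OF X_diff, of "- x" x] * by (simp add: power2_eq_square)
    qed
    show ?case
      using X upper lower
      by (auto simp: matrix_vector_mult_diff_rdistrib inner_diff_right algebra_simps)
  next
    case (Suc i)
    then show ?case
      using riccati_step_upper[OF _ d0] riccati_step_lower[OF _ d0]
      by (simp add: psd_riccati dS)
  qed
  then show "psd ((riccati A' B' Q R ^^ i) X)"
    and "\<bar>x \<bullet> (((riccati A' B' Q R ^^ i) X - P) *v x)\<bar> \<le> d i * (x \<bullet> (P *v x))"
    by (auto simp: matrix_vector_mult_diff_rdistrib inner_diff_right algebra_simps abs_le_iff)
qed

text \<open>Returns from relative to absolute error by P \<le> p I; together with the division by
  \<open>s\<close> this produces the factor \<open>b\<close>.\<close>

lemma spec_norm_riccati_iterate: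
  fixes X :: "real^'n^'n"
  assumes X: "psd X" and X_diff: "spec_norm (X - P) \<le> ep" and g: "g < 1"
  shows "spec_norm ((riccati A' B' Q R ^^ i) X - P)
    \<le> sqrt a * b * (g ^ i * ep + psi_tilde U e * (1 - g ^ i) / (1 - g))"
proof (rule spec_norm_le_symmetric)
  have "transpose (M - N) = transpose M - transpose N" for M N :: "real^'n^'n"
    by (simp add: transpose_def vec_eq_iff)
  then show "transpose ((riccati A' B' Q R ^^ i) X - P) = (riccati A' B' Q R ^^ i) X - P"
    using riccati_iterate_bounds(1)[OF X X_diff g, of i] sym_P by (simp add: psd_def)
next
  fix x
  define E where "E = g ^ i * ep + psi_tilde U e * (1 - g ^ i) / (1 - g)"
  have E0: "0 \<le> E"
    using ep g g_nonneg psi_tilde_nonneg power_le_one[of g i] unfolding E_def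
    by (intro divide_nonneg_nonneg add_nonneg_nonneg mult_nonneg_nonneg) auto
  have "\<bar>x \<bullet> (((riccati A' B' Q R ^^ i) X - P) *v x)\<bar> \<le> E / s * (x \<bullet> (P *v x))"
    using riccati_iterate_bounds(2)[OF X X_diff g] by (simp add: E_def)
  also have "\<dots> \<le> E / s * (p * (norm x)\<^sup>2)"
    using P_upper E0 s_ge_1 by (intro mult_left_mono) auto
  also have "\<dots> = 1 * (b * E * (norm x)\<^sup>2)" by simp
  \<comment> \<open>The estimate so far has constant 1; a \<ge> 1 relaxes it to the stated
    form.\<close>
  also have "\<dots> \<le> sqrt a * (b * E * (norm x)\<^sup>2)"
    using a_ge_1 b_ge_1 E0 by (intro mult_right_mono mult_nonneg_nonneg) auto
  finally show "\<bar>x \<bullet> (((riccati A' B' Q R ^^ i) X - P) *v x)\<bar> \<le> sqrt a * b * E * (norm x)\<^sup>2"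
    by (simp add: mult.assoc)
qed

end

end

theorem theorem2:
  fixes Astar Ahat :: "real^'n^'n" and Bstar Bhat :: "real^'m^'n"
    and Q Pstar P :: "real^'n^'n" and R :: "real^'m^'m"
    and Ups em ep :: real and i :: nat
  assumes "CARD('m) \<le> CARD('n)"
    and "psd Q" and "psd (Q - mat 1)"
    and "psd R" and "psd (R - mat 1)"
    and "stabilizable Astar Bstar"
    and "pd Pstar" and "Pstar = riccati Astar Bstar Q R Pstar"
    and "spec_norm Astar \<le> Ups" and "spec_norm Bstar \<le> Ups" and "spec_norm Pstar \<le> Ups"
    and "Ups \<ge> max 1 em"
    and "spec_norm (Ahat - Astar) \<le> em" and "spec_norm (Bhat - Bstar) \<le> em"
    and "psd P" and "spec_norm (P - Pstar) \<le> ep" and "ep \<ge> 0"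
    and "em < 1 / (8 * (spec_norm Pstar)^2)"
    and "gamma1 Ups (spec_norm Pstar / sigma_min Q) em ep
         * gamma2 (spec_norm Pstar) (spec_norm Pstar / sigma_min Q) em < 1"
  shows "let beta = spec_norm Pstar / sigma_min Q;
             g = gamma1 Ups beta em ep * gamma2 (spec_norm Pstar) beta em
         in spec_norm ((riccati Ahat Bhat Q R ^^ i) P - Pstar)
            \<le> sqrt (alpha_fn (spec_norm Pstar) em) * beta *
               (g ^ i * ep + psi_tilde Ups em * (1 - g ^ i) / (1 - g))"
proof -
  interpret lqr_perturbation Q R Astar Ahat Bstar Bhat Pstar Ups em
    by standard (use assms in auto)
  show ?thesis
    \<comment> \<open>\<open>refl\<close> instantiates \<open>g\<close> with the product of the two
      factors.\<close>
    using spec_norm_riccati_iterate[OF assms(17) refl assms(15,16,19)] by (simp add: Let_def)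
qed

end
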